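(* Let $n$ be a positive integer and let $F:\{0,1\}^n\to\{0,1\}^n$ be a map. If $G_F(x)$ has no negative circuit for all $x\in\{0,1\}^n$, and if there exists a vertex $i\in\{1,\dots,n\}$ such that, for all $x\in\{0,1\}^n$, all the positive circuits of $G_F(x)$ contain $i$, then $F$ has at least one fixed point.
   Context: Write $F(x)=(f_1(x),\dots,f_n(x))$ for $x=(x_1,\dots,x_n)\in\{0,1\}^n$. For $i,j\in\{1,\dots,n\}$ and $x\in\{0,1\}^n$, set $$f_{ij}(x)=f_i(x_1,\dots,x_{j-1},1,x_{j+1},\dots,x_n)-f_i(x_1,\dots,x_{j-1},0,x_{j+1},\dots,x_n)\in\{-1,0,1\}.$$ The interaction graph $G_F(x)$ of $F$ evaluated at $x$ is the signed directed graph on the vertex set $\{1,\dots,n\}$ that contains an arc from $j$ to $i$ if and only if $f_{ij}(x)\neq 0$; the sign of this arc is $f_{ij}(x)$. Loops are allowed. A circuit of length $p\ge 1$ in $G_F(x)$ is a sequence of $p$ distinct vertices $i_1,\dots,i_p$ such that $G_F(x)$ has an arc from $i_k$ to $i_{k+1}$ for $1\le k<p$ and an arc from $i_p$ to $i_1$ (so a loop is a circuit of length one). The sign of a circuit in $G_F(x)$ is the product of the signs of its arcs in $G_F(x)$; the circuit is positive (resp. negative) if this product is $+1$ (resp. $-1$). A circuit contains $i$ if $i$ is one of its vertices. *)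

theory Defs
  imports Complex_Main "HOL-Library.FuncSet"
begin

(* The points of {0,1}^n are extensional functions (undefined outside {1..n}),
   so that equality of functions is equality of points of the cube. *)
definition cube :: "nat \<Rightarrow> (nat \<Rightarrow> int) set" where
  "cube n = {1..n} \<rightarrow>\<^sub>E {0, 1}"

(* discrete_deriv F i j x is f_ij(x) *)
definition discrete_deriv ::
    "((nat \<Rightarrow> int) \<Rightarrow> nat \<Rightarrow> int) \<Rightarrow> nat \<Rightarrow> nat \<Rightarrow> (nat \<Rightarrow> int) \<Rightarrow> int" where
  "discrete_deriv F i j x = F (x(j := 1)) i - F (x(j := 0)) i"

(* A pair (j, i) is the arc from j to i; its sign is discrete_deriv F i j x. *)
definition interaction_arcs ::
    "nat \<Rightarrow> ((nat \<Rightarrow> int) \<Rightarrow> nat \<Rightarrow> int) \<Rightarrow> (nat \<Rightarrow> int) \<Rightarrow> (nat \<times> nat) set" where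
  "interaction_arcs n F x = {(j, i). j \<in> {1..n} \<and> i \<in> {1..n} \<and> discrete_deriv F i j x \<noteq> 0}"

definition circuit ::
    "nat \<Rightarrow> ((nat \<Rightarrow> int) \<Rightarrow> nat \<Rightarrow> int) \<Rightarrow> (nat \<Rightarrow> int) \<Rightarrow> nat list \<Rightarrow> bool" where
  "circuit n F x vs \<longleftrightarrow>
     vs \<noteq> [] \<and> distinct vs \<and> set vs \<subseteq> {1..n} \<and>
     (\<forall>k < length vs. (vs ! k, vs ! (Suc k mod length vs)) \<in> interaction_arcs n F x)"

definition circuit_sign ::
    "((nat \<Rightarrow> int) \<Rightarrow> nat \<Rightarrow> int) \<Rightarrow> (nat \<Rightarrow> int) \<Rightarrow> nat list \<Rightarrow> int" where
  "circuit_sign F x vs =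
     (\<Prod>k < length vs. discrete_deriv F (vs ! (Suc k mod length vs)) (vs ! k) x)"

definition positive_circuit ::
    "nat \<Rightarrow> ((nat \<Rightarrow> int) \<Rightarrow> nat \<Rightarrow> int) \<Rightarrow> (nat \<Rightarrow> int) \<Rightarrow> nat list \<Rightarrow> bool" where
  "positive_circuit n F x vs \<longleftrightarrow> circuit n F x vs \<and> circuit_sign F x vs = 1"

definition negative_circuit ::
    "nat \<Rightarrow> ((nat \<Rightarrow> int) \<Rightarrow> nat \<Rightarrow> int) \<Rightarrow> (nat \<Rightarrow> int) \<Rightarrow> nat list \<Rightarrow> bool" where
  "negative_circuit n F x vs \<longleftrightarrow> circuit n F x vs \<and> circuit_sign F x vs = -1"

end

theory Submission imports Defs begin

text \<open>
  Freezing the coordinate \<open>i\<close> leaves a network without circuits, which has a fixed point by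
  induction on the number of coordinates. If the partial fixed points \<open>y0\<close> and \<open>y1\<close> obtained for
  \<open>x i = 0\<close> and \<open>x i = 1\<close> both fail to be fixed points of \<open>F\<close>, then they are two distinct
  fixed points of the map \<open>F'\<close> that negates the \<open>i\<close>-th component of \<open>F\<close>. Two fixed points of \<open>F'\<close>
  force a positive circuit in some interaction graph of \<open>F'\<close>; seen in \<open>F\<close>, it is either a positive
  circuit avoiding \<open>i\<close> or a negative circuit through \<open>i\<close>.

  For the positive circuit, take two points \<open>a\<close>, \<open>b\<close> that are fixed on the set \<open>D\<close> of coordinates
  where they differ, with \<open>D\<close> of least size. By minimality, flipping any coordinate of \<open>D\<close> in \<open>a\<close>
  changes the image at some coordinate of \<open>D\<close>, so every vertex of \<open>D\<close> has a successor in \<open>D\<close>, and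
  an arc from \<open>j\<close> to \<open>k\<close> found in this way has sign \<open>(b j - a j) * (b k - a k)\<close>.
\<close>

text \<open>An orbit inside a finite set repeats, so some \<open>y\<close> on it returns to itself;
  its iterates over one least period form the list.\<close>

lemma ex_cycle_of_self_map:
  assumes "finite D" "D \<noteq> {}" and g: "g ` D \<subseteq> D"
  obtains vs where "vs \<noteq> []" "distinct vs" "set vs \<subseteq> D"
    "\<And>k. k < length vs \<Longrightarrow> vs ! (Suc k mod length vs) = g (vs ! k)"
proof -
  obtain x where "x \<in> D" using assms(2) by blast
  have orbit: "(g ^^ k) z \<in> D" if "z \<in> D" for k z
    using g that by (induction k) auto
  have "range (\<lambda>k. (g ^^ k) x) \<subseteq> D" using orbit[OF \<open>x \<in> D\<close>] by blast
  then have "\<not> inj (\<lambda>k. (g ^^ k) x)"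
    using finite_subset[OF _ \<open>finite D\<close>] finite_imageD[of _ UNIV] infinite_UNIV_nat by blast
  then obtain m k where "m < k" and eq: "(g ^^ m) x = (g ^^ k) x"
    using linorder_injI[of "\<lambda>k. (g ^^ k) x"] by blast
  define y where "y = (g ^^ m) x"
  have "(g ^^ (k - m)) y = (g ^^ (k - m + m)) x"
    unfolding y_def funpow_add by simp
  with \<open>m < k\<close> eq have ex: "\<exists>p>0. (g ^^ p) y = y"
    by (intro exI[of _ "k - m"]) (simp add: y_def)
  define p where "p = (LEAST p. p > 0 \<and> (g ^^ p) y = y)"
  have p: "p > 0" "(g ^^ p) y = y"
    using LeastI_ex[OF ex] by (auto simp: p_def)
  have least: "(g ^^ q) y \<noteq> y" if "0 < q" "q < p" for q
    using not_less_Least that unfolding p_def by blast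
  have neq: "(g ^^ r) y \<noteq> (g ^^ s) y" if "r < s" "s < p" for r s
  proof
    assume "(g ^^ r) y = (g ^^ s) y"
    \<comment> \<open>\<open>p - s\<close> further iterations carry the right side to
      \<open>(g ^^ p) y = y\<close>, making \<open>p - s + r\<close> a positive period below
      \<open>p\<close>.\<close>
    then have "(g ^^ (p - s)) ((g ^^ r) y) = (g ^^ (p - s)) ((g ^^ s) y)" by simp
    then have "(g ^^ (p - s + r)) y = (g ^^ (p - s + s)) y"
      by (simp only: funpow_add o_apply)
    with that p have "(g ^^ (p - s + r)) y = y" by simp
    with least[of "p - s + r"] that show False by simp
  qed
  define vs where "vs = map (\<lambda>k. (g ^^ k) y) [0..<p]"
  show ?thesis
  proof
    show "vs \<noteq> []" using p by (simp add: vs_def)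
    show "distinct vs"
      unfolding vs_def distinct_map by (auto simp: inj_on_def) (metis neq linorder_neqE_nat)
    show "set vs \<subseteq> D"
      using orbit[OF orbit[OF \<open>x \<in> D\<close>]] by (auto simp: vs_def y_def)
    show "vs ! (Suc k mod length vs) = g (vs ! k)" if "k < length vs" for k
    proof -
      have "k < p" using that by (simp add: vs_def)
      \<comment> \<open>At the wrap-around \<open>Suc k = p\<close> the index becomes 0, which is
        harmless because \<open>p\<close> is a period.\<close>
      have "(g ^^ (Suc k mod p)) y = (g ^^ Suc k) y"
        using p(2) \<open>k < p\<close> by (cases "Suc k = p") simp_all
      with \<open>k < p\<close> show ?thesis by (simp add: vs_def)
    qed
  qed
qed

lemma prod_nth_distinct:
  assumes "distinct vs"
  shows "(\<Prod>k<length vs. h (vs ! k)) = prod h (set vs)"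
  using assms prod.distinct_set_conv_list[of vs h]
  by (simp add: prod.list_conv_set_nth atLeast0LessThan)

text \<open>The shifted indices read off \<open>rotate1 vs\<close>, which has the same
  entries.\<close>

lemma prod_nth_Suc_mod_distinct:
  assumes "distinct vs"
  shows "(\<Prod>k<length vs. h (vs ! (Suc k mod length vs))) = prod h (set vs)"
  using prod_nth_distinct[of "rotate1 vs" h] assms by (simp add: nth_rotate1)

lemma cube_values: "x \<in> cube n \<Longrightarrow> j \<in> {1..n} \<Longrightarrow> x j = 0 \<or> x j = 1"
  by (auto simp: cube_def PiE_def Pi_def)

lemma cube_upd: "x \<in> cube n \<Longrightarrow> j \<in> {1..n} \<Longrightarrow> v \<in> {0, 1} \<Longrightarrow> x(j := v) \<in> cube n"
  by (auto simp: cube_def PiE_def Pi_def extensional_def)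

lemma cube_eqI:
  "x \<in> cube n \<Longrightarrow> y \<in> cube n \<Longrightarrow> (\<And>j. j \<in> {1..n} \<Longrightarrow> x j = y j) \<Longrightarrow> x = y"
  unfolding cube_def by (rule PiE_ext)

lemma abs_prod_eq_1:
  fixes h :: "'a \<Rightarrow> 'b::linordered_idom"
  shows "(\<And>k. k \<in> A \<Longrightarrow> \<bar>h k\<bar> = 1) \<Longrightarrow> \<bar>prod h A\<bar> = 1"
  by (induction A rule: infinite_finite_induct) (simp_all add: abs_mult)

text \<open>Each arc carries a nonzero difference of two values in {0, 1}. Hence excluding both
  signs excludes all circuits.\<close>

lemma circuit_sign_cases:
  assumes F: "F \<in> cube n \<rightarrow> cube n" and x: "x \<in> cube n" and vs: "circuit n F x vs"
  shows "circuit_sign F x vs = 1 \<or> circuit_sign F x vs = -1"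
proof -
  have abs1: "\<bar>discrete_deriv F k j x\<bar> = 1" if "(j, k) \<in> interaction_arcs n F x" for j k
  proof -
    have jk: "j \<in> {1..n}" "k \<in> {1..n}" "discrete_deriv F k j x \<noteq> 0"
      using that by (auto simp: interaction_arcs_def)
    then have "F (x(j := 1)) \<in> cube n" "F (x(j := 0)) \<in> cube n"
      using F x cube_upd[of x n j] by auto
    with jk cube_values[OF _ jk(2)] show ?thesis
      unfolding discrete_deriv_def by (smt (verit))
  qed
  have "\<bar>circuit_sign F x vs\<bar> = 1"
    unfolding circuit_sign_def
    by (rule abs_prod_eq_1) (use vs abs1 in \<open>auto simp: circuit_def\<close>)
  then show ?thesis by linarith
qed

text \<open>Fixedness is asked only where \<open>a\<close> and \<open>b\<close> differ, so that it
  can survive moving \<open>a\<close> one coordinate towards \<open>b\<close>; the induction is on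
  their Hamming distance.\<close>

lemma positive_circuit_of_fixed_pair:
  assumes F: "F \<in> cube n \<rightarrow> cube n"
    and "a \<in> cube n" "b \<in> cube n" "a \<noteq> b"
    and "\<And>j. j \<in> {1..n} \<Longrightarrow> a j \<noteq> b j \<Longrightarrow> F a j = a j \<and> F b j = b j"
  shows "\<exists>x\<in>cube n. \<exists>vs. positive_circuit n F x vs \<and> set vs \<subseteq> {j \<in> {1..n}. a j \<noteq> b j}"
  using assms(2-5)
proof (induction "card {j \<in> {1..n}. a j \<noteq> b j}" arbitrary: a rule: less_induct)
  case less
  define D where "D = {j \<in> {1..n}. a j \<noteq> b j}"
  note a = less.prems(1) and b = less.prems(2)
  have "finite D" "D \<subseteq> {1..n}" by (auto simp: D_def)
  have "D \<noteq> {}" using cube_eqI[OF a b] less.prems(3) by (auto simp: D_def)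
  have fixed: "F a j = a j" "F b j = b j" if "j \<in> D" for j
    using that less.prems(4) by (auto simp: D_def)
  have flip_cube: "a(j := b j) \<in> cube n" if "j \<in> D" for j
    using that a b cube_values[of b n j] by (intro cube_upd) (auto simp: D_def)
  show ?case
  proof (cases "\<forall>j\<in>D. \<exists>k\<in>D. F (a(j := b j)) k \<noteq> a k")
    case True
    then obtain g where g: "\<And>j. j \<in> D \<Longrightarrow> g j \<in> D \<and> F (a(j := b j)) (g j) \<noteq> a (g j)"
      by metis
    define s where "s j = b j - a j" for j
    have s: "s j * s j = 1" if "j \<in> D" for j
      using that cube_values[OF a, of j] cube_values[OF b, of j] by (auto simp: D_def s_def)
    have deriv: "discrete_deriv F (g j) j a = s j * s (g j)" if j: "j \<in> D" for j
    proof -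
      have gj: "g j \<in> D" "F (a(j := b j)) (g j) \<noteq> a (g j)" using g[OF j] by auto
      have "F (a(j := b j)) \<in> cube n" using F flip_cube[OF j] by auto
      then have flip: "F (a(j := b j)) (g j) = b (g j)"
        using gj cube_values[of "F (a(j := b j))" n "g j"] cube_values[OF a, of "g j"]
          cube_values[OF b, of "g j"] by (auto simp: D_def)
      \<comment> \<open>One of the two points compared by the derivative is \<open>a\<close>, the
        other its flip at \<open>j\<close>; which is which depends on \<open>a j\<close> and
        accounts for the factor \<open>s j\<close>.\<close>
      have "a(j := a j) = a" by simp
      with flip fixed(1)[OF gj(1)] j cube_values[OF a, of j] cube_values[OF b, of j]
      show ?thesis by (auto simp: D_def s_def discrete_deriv_def fun_upd_idem)
    qed
    obtain vs where vs: "vs \<noteq> []" "distinct vs" "set vs \<subseteq> D"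
      and succ: "\<And>k. k < length vs \<Longrightarrow> vs ! (Suc k mod length vs) = g (vs ! k)"
      using ex_cycle_of_self_map[OF \<open>finite D\<close> \<open>D \<noteq> {}\<close>, of g] g by blast
    have in_D: "vs ! k \<in> D" if "k < length vs" for k using vs that by auto
    have D_range: "j \<in> {1..n}" "g j \<in> {1..n}" if "j \<in> D" for j
      using that g[OF that] by (auto simp: D_def)
    have nonzero: "s j \<noteq> 0" if "j \<in> D" for j using s[OF that] by auto
    have "circuit n F a vs"
      unfolding circuit_def interaction_arcs_def
      using vs \<open>D \<subseteq> {1..n}\<close> in_D D_range g by (simp add: succ deriv nonzero)
    \<comment> \<open>Each vertex is once the tail and once the head of an arc, so its factor
      \<open>s\<close> occurs squared.\<close>
    moreover have "circuit_sign F a vs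
        = (\<Prod>k<length vs. s (vs ! k)) * (\<Prod>k<length vs. s (vs ! (Suc k mod length vs)))"
      unfolding circuit_sign_def prod.distrib[symmetric]
      by (intro prod.cong) (auto simp: succ deriv in_D)
    then have "circuit_sign F a vs = (\<Prod>j\<in>set vs. s j * s j)"
      using vs by (simp add: prod_nth_distinct prod_nth_Suc_mod_distinct prod.distrib)
    then have "circuit_sign F a vs = 1"
      using s vs by (simp add: subset_iff)
    ultimately show ?thesis
      using a vs unfolding positive_circuit_def D_def by blast
  next
    case False
    then obtain j where j: "j \<in> D" and stay: "\<And>k. k \<in> D \<Longrightarrow> F (a(j := b j)) k = a k"
      by blast
    let ?a = "a(j := b j)"
    have D': "{k \<in> {1..n}. ?a k \<noteq> b k} = D - {j}"
      by (auto simp: D_def)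
    \<comment> \<open>The images of \<open>?a\<close> and \<open>b\<close> have the distinct values
      \<open>a j\<close> and \<open>b j\<close> at \<open>j\<close>.\<close>
    have "?a \<noteq> b"
      using stay[OF j] fixed(2)[OF j] j by (auto simp: D_def)
    moreover have "card {k \<in> {1..n}. ?a k \<noteq> b k} < card {k \<in> {1..n}. a k \<noteq> b k}"
      unfolding D' D_def[symmetric] using \<open>finite D\<close> j by (rule card_Diff1_less)
    moreover have "F ?a k = ?a k \<and> F b k = b k" if "k \<in> {1..n}" "?a k \<noteq> b k" for k
    proof -
      have "k \<in> D - {j}" using that unfolding D'[symmetric] by blast
      then show ?thesis using stay[of k] fixed[of k] by auto
    qed
    ultimately have "\<exists>x\<in>cube n. \<exists>vs. positive_circuit n F x vs
        \<and> set vs \<subseteq> {k \<in> {1..n}. ?a k \<noteq> b k}"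
      using less.hyps[of ?a] flip_cube[OF j] b by blast
    then show ?thesis unfolding D' D_def by blast
  qed
qed

definition negate_component :: "nat \<Rightarrow> ('a \<Rightarrow> nat \<Rightarrow> int) \<Rightarrow> 'a \<Rightarrow> nat \<Rightarrow> int" where
  "negate_component i F x = (F x)(i := 1 - F x i)"

lemma negate_component_cube:
  assumes "F \<in> cube n \<rightarrow> cube n" "i \<in> {1..n}"
  shows "negate_component i F \<in> cube n \<rightarrow> cube n"
proof
  fix x assume "x \<in> cube n"
  then have "F x \<in> cube n" using assms(1) by auto
  then show "negate_component i F x \<in> cube n"
    unfolding negate_component_def using assms(2) cube_values[of "F x" n i]
    by (intro cube_upd) auto
qed

lemma discrete_deriv_negate_component:
  "discrete_deriv (negate_component i F) k j x
    = (if k = i then -1 else 1) * discrete_deriv F k j x"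
  by (simp add: discrete_deriv_def negate_component_def)

lemma circuit_negate_component:
  "circuit n (negate_component i F) x vs \<longleftrightarrow> circuit n F x vs"
  by (auto simp: circuit_def interaction_arcs_def discrete_deriv_negate_component)

text \<open>Only arcs entering \<open>i\<close> change sign, and a circuit through \<open>i\<close>
  has exactly one of them.\<close>

lemma circuit_sign_negate_component:
  assumes "distinct vs"
  shows "circuit_sign (negate_component i F) x vs
    = (if i \<in> set vs then -1 else 1) * circuit_sign F x vs"
proof -
  have "circuit_sign (negate_component i F) x vs
      = (\<Prod>j\<in>set vs. if j = i then -1 else 1) * circuit_sign F x vs"
    unfolding circuit_sign_def discrete_deriv_negate_component prod.distrib
    using prod_nth_Suc_mod_distinct[OF assms, of "\<lambda>j. if j = i then -1 else 1 :: int"] by simp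
  then show ?thesis by (simp add: prod.delta)
qed

text \<open>This step serves twice: to build up circuit-free sets vertex by vertex, and to add the
  distinguished vertex at the end.\<close>

lemma partial_fixed_point_insert:
  assumes F: "F \<in> cube n \<rightarrow> cube n" and i: "i \<in> {1..n}" and c: "c \<in> cube n"
    and partial: "\<And>c. c \<in> cube n \<Longrightarrow>
      \<exists>y\<in>cube n. (\<forall>j. j \<notin> S \<longrightarrow> y j = c j) \<and> (\<forall>j\<in>S. F y j = y j)"
    and "i \<notin> S"
    and no_negative: "\<And>x vs. x \<in> cube n \<Longrightarrow> set vs \<subseteq> insert i S \<Longrightarrow> \<not> negative_circuit n F x vs"
    and positive: "\<And>x vs. x \<in> cube n \<Longrightarrow> set vs \<subseteq> insert i S \<Longrightarrow>
      positive_circuit n F x vs \<Longrightarrow> i \<in> set vs"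
  shows "\<exists>y\<in>cube n. (\<forall>j. j \<notin> insert i S \<longrightarrow> y j = c j) \<and> (\<forall>j\<in>insert i S. F y j = y j)"
proof (rule ccontr)
  assume no_fixed: "\<not> ?thesis"
  \<comment> \<open>Solve on \<open>S\<close> with coordinate \<open>i\<close> frozen at
    \<open>v\<close>; as the solution must fail at \<open>i\<close>, the image there is the other
    value.\<close>
  have ex: "\<exists>y\<in>cube n. (\<forall>j. j \<notin> insert i S \<longrightarrow> y j = c j) \<and> y i = v
      \<and> (\<forall>j\<in>S. F y j = y j) \<and> F y i = 1 - v" if v: "v \<in> {0, 1}" for v
  proof -
    obtain y where y: "y \<in> cube n" "\<And>j. j \<notin> S \<Longrightarrow> y j = (c(i := v)) j" "\<forall>j\<in>S. F y j = y j"
      using partial[OF cube_upd[OF c i v]] by blast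
    have yi: "y i = v" using y(2)[OF \<open>i \<notin> S\<close>] by simp
    have outside: "\<forall>j. j \<notin> insert i S \<longrightarrow> y j = c j" using y(2) by simp
    have "F y i \<noteq> v"
    proof
      assume "F y i = v"
      with y(3) yi have "\<forall>j\<in>insert i S. F y j = y j" by simp
      with no_fixed y(1) outside show False by blast
    qed
    moreover have "F y i = 0 \<or> F y i = 1"
      using F y(1) i by (intro cube_values) auto
    ultimately have "F y i = 1 - v" using v by auto
    with y outside yi show ?thesis by blast
  qed
  obtain y0 where y0: "y0 \<in> cube n" "\<forall>j. j \<notin> insert i S \<longrightarrow> y0 j = c j" "y0 i = 0"
      "\<forall>j\<in>S. F y0 j = y0 j" "F y0 i = 1"
    using ex[of 0] by auto
  obtain y1 where y1: "y1 \<in> cube n" "\<forall>j. j \<notin> insert i S \<longrightarrow> y1 j = c j" "y1 i = 1"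
      "\<forall>j\<in>S. F y1 j = y1 j" "F y1 i = 0"
    using ex[of 1] by auto
  let ?F = "negate_component i F"
  \<comment> \<open>Both points agree with \<open>c\<close> elsewhere, which confines the circuit
    found below to \<open>insert i S\<close>.\<close>
  have differ: "j \<in> insert i S" if "y0 j \<noteq> y1 j" for j
    using that y0(2) y1(2) by force
  have "?F y0 j = y0 j \<and> ?F y1 j = y1 j" if "y0 j \<noteq> y1 j" for j
    using differ[OF that] y0 y1 by (auto simp: negate_component_def)
  moreover have "y0 \<noteq> y1" using y0(3) y1(3) by auto
  ultimately obtain x vs where x: "x \<in> cube n" "positive_circuit n ?F x vs"
    "set vs \<subseteq> {j \<in> {1..n}. y0 j \<noteq> y1 j}"
    using positive_circuit_of_fixed_pair[OF negate_component_cube[OF F i] y0(1) y1(1)] by metis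
  then have vs: "circuit n F x vs" "circuit_sign ?F x vs = 1" "set vs \<subseteq> insert i S"
    using differ by (auto simp: positive_circuit_def circuit_negate_component)
  then have "distinct vs" by (simp add: circuit_def)
  show False
  proof (cases "i \<in> set vs")
    case True
    with vs \<open>distinct vs\<close> have "negative_circuit n F x vs"
      by (simp add: circuit_sign_negate_component negative_circuit_def)
    with no_negative x(1) vs(3) show False by blast
  next
    case False
    with vs \<open>distinct vs\<close> have "positive_circuit n F x vs"
      by (simp add: circuit_sign_negate_component positive_circuit_def)
    with positive x(1) vs(3) False show False by blast
  qed
qed

text \<open>Without circuits, both circuit conditions of the insertion step hold vacuously. The
  prescribed point \<open>c\<close> stays general because that step also solves for
  \<open>c(i := v)\<close>.\<close>

lemma partial_fixed_point_if_no_circuit: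
  assumes F: "F \<in> cube n \<rightarrow> cube n" and "S \<subseteq> {1..n}"
    and "\<And>x vs. x \<in> cube n \<Longrightarrow> set vs \<subseteq> S \<Longrightarrow> \<not> circuit n F x vs"
    and "c \<in> cube n"
  shows "\<exists>y\<in>cube n. (\<forall>j. j \<notin> S \<longrightarrow> y j = c j) \<and> (\<forall>j\<in>S. F y j = y j)"
  using finite_subset[OF assms(2) finite_atLeastAtMost] assms(2-4)
proof (induction S arbitrary: c rule: finite_induct)
  case empty
  then show ?case by auto
next
  case (insert i S)
  have no_circuit: "\<not> circuit n F x vs" if "x \<in> cube n" "set vs \<subseteq> insert i S" for x vs
    using insert.prems(2) that by blast
  show ?case
  proof (rule partial_fixed_point_insert[OF F])
    show "\<exists>y\<in>cube n. (\<forall>j. j \<notin> S \<longrightarrow> y j = c j) \<and> (\<forall>j\<in>S. F y j = y j)" if "c \<in> cube n" for c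
      using insert.IH[OF _ _ that] insert.prems(1) no_circuit by blast
  qed (use insert no_circuit in \<open>auto simp: negative_circuit_def positive_circuit_def\<close>)
qed

theorem theorem4:
  fixes n :: nat and F :: "(nat \<Rightarrow> int) \<Rightarrow> (nat \<Rightarrow> int)"
  assumes "n \<ge> 1"
    and "F \<in> cube n \<rightarrow> cube n"
    and "\<forall>x \<in> cube n. \<not> (\<exists>vs. negative_circuit n F x vs)"
    and "\<exists>i \<in> {1..n}. \<forall>x \<in> cube n. \<forall>vs. positive_circuit n F x vs \<longrightarrow> i \<in> set vs"
  shows "\<exists>x \<in> cube n. F x = x"
proof -
  obtain i where i: "i \<in> {1..n}"
    and positive: "\<And>x vs. x \<in> cube n \<Longrightarrow> positive_circuit n F x vs \<Longrightarrow> i \<in> set vs"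
    using assms(4) by blast
  let ?S = "{1..n} - {i}"
  have S: "insert i ?S = {1..n}" using i by blast
  \<comment> \<open>A circuit within \<open>?S\<close> misses \<open>i\<close>, so it can be neither
    positive nor negative.\<close>
  have no_circuit: "\<not> circuit n F x vs" if "x \<in> cube n" "set vs \<subseteq> ?S" for x vs
    using circuit_sign_cases[OF assms(2) that(1)] that assms(3) positive
    unfolding negative_circuit_def positive_circuit_def by blast
  have partial: "\<exists>y\<in>cube n. (\<forall>j. j \<notin> ?S \<longrightarrow> y j = c j) \<and> (\<forall>j\<in>?S. F y j = y j)"
    if "c \<in> cube n" for c
    using partial_fixed_point_if_no_circuit[OF assms(2) Diff_subset no_circuit that] by blast
  \<comment> \<open>Any point of the cube would do as \<open>c\<close>: no coordinate in
    \<open>{1..n}\<close> lies outside \<open>insert i ?S\<close>.\<close>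
  have "restrict (\<lambda>_. 0) {1..n} \<in> cube n" by (auto simp: cube_def)
  from partial_fixed_point_insert[OF assms(2) i this partial] assms(3) positive
  obtain y where y: "y \<in> cube n" "\<forall>j\<in>insert i ?S. F y j = y j" by blast
  then have "F y = y"
    unfolding S using assms(2) by (intro cube_eqI[of _ n]) auto
  with y(1) show ?thesis by blast
qed

end
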